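(* Let $(X_t)_{t=1}^\infty$ be a nonnegative reverse submartingale, and $\tau$ a reverse stopping time, both with respect to a reverse filtration $(\mathcal E_t)_{t=1}^\infty$. Let $U\sim\mathrm{Unif}(0,1)$ be independent of $(\mathcal E_t)_{t=1}^\infty$. Then for any $a>0$, $$P(X_\tau\ge U/a)\le a\,\mathbb E[X_1].$$
   Context: A reverse filtration is a nonincreasing sequence of $\sigma$-algebras $\mathcal E_1\supseteq\mathcal E_2\supseteq\cdots$. A process $(X_t)_{t\ge1}$ is a reverse submartingale with respect to it if each $X_t$ is integrable and $\mathcal E_t$-measurable and $\mathbb E[X_t\mid\mathcal E_{t+1}]\ge X_{t+1}$ almost surely for all $t\ge1$. A reverse stopping time is a random variable $\tau$ with values in $\{1,2,\dots\}$ such that $\{\tau=t\}\in\mathcal E_t$ for all $t\ge1$. *)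

theory Defs
  imports "HOL-Probability.Probability"
begin

text \<open>Time runs over the positive integers: the values at index 0 of the sequences
  \<open>E :: nat \<Rightarrow> 'a measure\<close> and \<open>X :: nat \<Rightarrow> 'a \<Rightarrow> real\<close> are never constrained or used. As in
  \<^theory>\<open>HOL-Probability.Conditional_Expectation\<close>, a sub-sigma-algebra is represented by a measure
  of which only \<^const>\<open>space\<close> and \<^const>\<open>sets\<close> matter.\<close>

definition reverse_filtration :: "'a measure \<Rightarrow> (nat \<Rightarrow> 'a measure) \<Rightarrow> bool" where
  "reverse_filtration M E \<longleftrightarrow>
     (\<forall>t\<ge>1. subalgebra M (E t)) \<and>
     (\<forall>t\<ge>1. sets (E (t + 1)) \<subseteq> sets (E t))"

definition reverse_submartingale ::
  "'a measure \<Rightarrow> (nat \<Rightarrow> 'a measure) \<Rightarrow> (nat \<Rightarrow> 'a \<Rightarrow> real) \<Rightarrow> bool" where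
  "reverse_submartingale M E X \<longleftrightarrow>
     (\<forall>t\<ge>1. integrable M (X t) \<and> X t \<in> borel_measurable (E t)) \<and>
     (\<forall>t\<ge>1. AE \<omega> in M. real_cond_exp M (E (t + 1)) (X t) \<omega> \<ge> X (t + 1) \<omega>)"

definition reverse_stopping_time ::
  "'a measure \<Rightarrow> (nat \<Rightarrow> 'a measure) \<Rightarrow> ('a \<Rightarrow> nat) \<Rightarrow> bool" where
  "reverse_stopping_time M E \<tau> \<longleftrightarrow>
     \<tau> \<in> measurable M (count_space UNIV) \<and>
     (\<forall>\<omega>\<in>space M. \<tau> \<omega> \<ge> 1) \<and>
     (\<forall>t\<ge>1. {\<omega> \<in> space M. \<tau> \<omega> = t} \<in> sets (E t))"

text \<open>Independence of \<open>U\<close> from the whole family \<open>(E t)\<close>, i.e. from the sigma-algebra generated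
  by all the \<open>E t\<close> together.\<close>

definition indep_of_family ::
  "'a measure \<Rightarrow> (nat \<Rightarrow> 'a measure) \<Rightarrow> ('a \<Rightarrow> real) \<Rightarrow> bool" where
  "indep_of_family M E U \<longleftrightarrow>
     prob_space.indep_set M
       {U -` B \<inter> space M | B. B \<in> sets borel}
       (sigma_sets (space M) (\<Union>t\<in>{1..}. sets (E t)))"

end

theory Submission
  imports Defs
begin

text \<open>Given the reverse filtration, the event \<open>a X\<^sub>\<tau> \<ge> U\<close> has conditional probability at most
  \<open>a X\<^sub>\<tau>\<close>, so it remains to see that \<open>E[X\<^sub>\<tau>] \<le> E[X\<^sub>1]\<close>. For the latter,
  \<open>{\<tau> = t}\<close> lies in every \<open>E\<^sub>s\<close> with \<open>s \<le> t\<close>, so the submartingale inequality can be iterated from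
  \<open>X\<^sub>t\<close> down to \<open>X\<^sub>1\<close> on this event; then one sums over \<open>t\<close>.\<close>

lemma reverse_submartingale_set_integral_le:
  assumes "prob_space M" and rf: "reverse_filtration M E" and sub: "reverse_submartingale M E X"
    and "1 \<le> t" and "A \<in> sets (E t)"
  shows "(\<integral>x\<in>A. X t x \<partial>M) \<le> (\<integral>x\<in>A. X 1 x \<partial>M)"
  using assms(4,5)
proof (induction t rule: dec_induct)
  case (step n)
  interpret prob_space M by fact
  have subalg: "subalgebra M (E (n + 1))"
    using rf step by (auto simp: reverse_filtration_def)
  interpret finite_measure_subalgebra M "E (n + 1)"
    using subalg by unfold_locales
  have int: "integrable M (X n)" "integrable M (X (n + 1))"
    using sub step by (auto simp: reverse_submartingale_def)
  \<comment> \<open>Membership in \<open>sets (E (n + 1))\<close> lets the conditional expectation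
    be dropped after integrating over \<open>A\<close>; membership in \<open>sets (E n)\<close>,
    which holds because the filtration decreases, makes the induction hypothesis applicable.\<close>
  have A: "A \<in> sets (E (n + 1))" "A \<in> sets M" "A \<in> sets (E n)"
    using step subalg rf by (auto simp: subalgebra_def reverse_filtration_def)
  have "(\<integral>x\<in>A. X (n + 1) x \<partial>M) \<le> (\<integral>x\<in>A. real_cond_exp M (E (n + 1)) (X n) x \<partial>M)"
    unfolding set_lebesgue_integral_def
  proof (rule integral_mono_AE)
    show "integrable M (\<lambda>x. indicat_real A x *\<^sub>R X (n + 1) x)"
      using integrable_mult_indicator[OF A(2) int(2)] .
    show "integrable M (\<lambda>x. indicat_real A x *\<^sub>R real_cond_exp M (E (n + 1)) (X n) x)"
      using integrable_mult_indicator[OF A(2) real_cond_exp_int(1)[OF int(1)]] .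
    have "AE x in M. X (n + 1) x \<le> real_cond_exp M (E (n + 1)) (X n) x"
      using sub step by (auto simp: reverse_submartingale_def)
    then show "AE x in M. indicat_real A x *\<^sub>R X (n + 1) x
        \<le> indicat_real A x *\<^sub>R real_cond_exp M (E (n + 1)) (X n) x"
      by eventually_elim (auto intro: mult_left_mono)
  qed
  also have "\<dots> = (\<integral>x\<in>A. X n x \<partial>M)"
    using real_cond_exp_intA[OF int(1) A(1)] by simp
  also have "\<dots> \<le> (\<integral>x\<in>A. X 1 x \<partial>M)"
    using step A by simp
  finally show ?case by simp
qed simp

text \<open>The exact value is \<open>min 1 y\<close>, so the bound covers thresholds beyond 1 as
  well; this matters because \<open>a * X t\<close> may be arbitrarily large.\<close>

lemma emeasure_uniform_unit_interval_atMost: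
  fixes y :: real
  assumes "0 \<le> y"
  shows "emeasure (uniform_measure lborel {0<..<1}) {..y} \<le> ennreal y"
proof -
  have "emeasure (uniform_measure lborel {0<..<1::real}) {..y} = emeasure lborel ({0<..<1} \<inter> {..y})"
    by (simp add: divide_ennreal_def)
  also have "\<dots> \<le> emeasure lborel {0..y}"
    by (intro emeasure_mono) auto
  finally show ?thesis using assms by simp
qed

text \<open>By independence the joint law of \<open>(U, Y)\<close> is a product. Slicing the half
  plane \<open>u \<le> y\<close> at fixed \<open>y\<close> gives the uniform mass of
  \<open>{..y}\<close>, which is at most \<open>y\<close>, and integrating over the law of
  \<open>Y\<close> gives the bound.\<close>

lemma (in prob_space) emeasure_indep_uniform_le:
  fixes U Y :: "'a \<Rightarrow> real"
  assumes U: "U \<in> borel_measurable M"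
    and unif: "distr M lborel U = uniform_measure lborel {0<..<1}"
    and Y: "Y \<in> borel_measurable M"
    and indep: "indep_var borel U borel Y"
    and nonneg: "\<And>x. x \<in> space M \<Longrightarrow> 0 \<le> Y x"
  shows "emeasure M {x \<in> space M. U x \<le> Y x} \<le> (\<integral>\<^sup>+x. ennreal (Y x) \<partial>M)"
proof -
  have distr: "distr M borel U = uniform_measure lborel {0<..<1}"
    using unif by (metis distr_cong sets_lborel)
  have S: "{p. fst p \<le> (snd p :: real)} \<in> sets (borel \<Otimes>\<^sub>M borel)"
    unfolding borel_prod by (intro borel_closed closed_Collect_le continuous_intros)
  have eq: "distr M (borel \<Otimes>\<^sub>M borel) (\<lambda>x. (U x, Y x)) = distr M borel U \<Otimes>\<^sub>M distr M borel Y"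
    using indep by (simp add: indep_var_distribution_eq)
  interpret PU: prob_space "distr M borel U" using U by (rule prob_space_distr)
  interpret PY: prob_space "distr M borel Y" using Y by (rule prob_space_distr)
  interpret pair_sigma_finite "distr M borel U" "distr M borel Y" ..
  have "{x \<in> space M. U x \<le> Y x} = (\<lambda>x. (U x, Y x)) -` {p. fst p \<le> snd p} \<inter> space M"
    by auto
  then have "emeasure M {x \<in> space M. U x \<le> Y x}
      = emeasure (distr M (borel \<Otimes>\<^sub>M borel) (\<lambda>x. (U x, Y x))) {p. fst p \<le> snd p}"
    using S U Y by (subst emeasure_distr) auto
  also have "\<dots> = (\<integral>\<^sup>+y. emeasure (distr M borel U) ((\<lambda>u. (u, y)) -` {p. fst p \<le> snd p}) \<partial>distr M borel Y)"
    unfolding eq using S by (intro emeasure_pair_measure_alt2) simp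
  also have "\<dots> = (\<integral>\<^sup>+y. emeasure (uniform_measure lborel {0<..<1}) {..y} \<partial>distr M borel Y)"
    unfolding distr by (simp add: vimage_def atMost_def)
  also have "\<dots> \<le> (\<integral>\<^sup>+y. ennreal y \<partial>distr M borel Y)"
  proof (rule nn_integral_mono_AE)
    \<comment> \<open>The law of \<open>Y\<close> is a measure on the whole real line, so the
      nonnegativity that the slice bound requires is available only almost everywhere.\<close>
    have "AE y in distr M borel Y. 0 \<le> y"
      using nonneg Y by (subst AE_distr_iff) auto
    then show "AE y in distr M borel Y.
        emeasure (uniform_measure lborel {0<..<1}) {..y} \<le> ennreal y"
      by eventually_elim (rule emeasure_uniform_unit_interval_atMost)
  qed
  also have "\<dots> = (\<integral>\<^sup>+x. ennreal (Y x) \<partial>M)"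
    using Y by (simp add: nn_integral_distr)
  finally show ?thesis .
qed

text \<open>Everything generated by \<open>Y\<close> lies in \<open>E t\<close>, hence in the
  sigma-algebra generated by the whole family, and independence passes to smaller collections of
  events.\<close>

lemma indep_of_family_imp_indep_var:
  assumes "prob_space M" and "reverse_filtration M E" and U: "U \<in> borel_measurable M"
    and indep: "indep_of_family M E U" and t: "1 \<le> t" and Y: "Y \<in> borel_measurable (E t)"
  shows "prob_space.indep_var M borel U borel (Y :: 'a \<Rightarrow> real)"
proof -
  interpret prob_space M by fact
  let ?G = "sigma_sets (space M) (\<Union>t\<in>{1..}. sets (E t))"
  have sub: "subalgebra M (E t)"
    using assms by (auto simp: reverse_filtration_def)
  \<comment> \<open>Preimages of Borel sets already form a sigma-algebra, which reconciles
    \<open>indep_of_family\<close> with the generated sigma-algebras in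
    \<open>indep_var_eq\<close>.\<close>
  have U_sets: "sigma_sets (space M) {U -` B \<inter> space M | B. B \<in> sets borel}
      = {U -` B \<inter> space M | B. B \<in> sets borel}"
    using sigma_sets_vimage_commute[of U "space M" "space borel" "sets borel"]
    by (simp add: sets.sigma_sets_eq[of borel, simplified])
  have "{Y -` B \<inter> space M | B. B \<in> sets borel} \<subseteq> sets (E t)"
    using measurable_sets[OF Y] sub by (auto simp: subalgebra_def)
  then have Y_sets: "sigma_sets (space M) {Y -` B \<inter> space M | B. B \<in> sets borel} \<subseteq> ?G"
    using t by (intro sigma_sets_mono) blast
  have "indep_set {U -` B \<inter> space M | B. B \<in> sets borel}
      (sigma_sets (space M) {Y -` B \<inter> space M | B. B \<in> sets borel})"
    using indep unfolding indep_of_family_def indep_set_def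
    by (rule indep_sets_mono_sets) (use Y_sets in \<open>auto split: bool.splits\<close>)
  then show ?thesis
    unfolding indep_var_eq U_sets using U measurable_from_subalg[OF sub Y] by blast
qed

theorem theorem5p2:
  fixes M :: "'a measure"
    and E :: "nat \<Rightarrow> 'a measure"
    and X :: "nat \<Rightarrow> 'a \<Rightarrow> real"
    and \<tau> :: "'a \<Rightarrow> nat"
    and U :: "'a \<Rightarrow> real"
    and a :: real
  assumes "prob_space M"
    and "reverse_filtration M E"
    and "reverse_submartingale M E X"
    and "\<forall>t\<ge>1. \<forall>\<omega>\<in>space M. X t \<omega> \<ge> 0"
    and "reverse_stopping_time M E \<tau>"
    and "U \<in> borel_measurable M"
    and "distr M lborel U = uniform_measure lborel {0<..<1}"
    and "indep_of_family M E U"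
    and "a > 0"
  shows "measure M {\<omega> \<in> space M. X (\<tau> \<omega>) \<omega> \<ge> U \<omega> / a} \<le> a * integral\<^sup>L M (X 1)"
proof -
  interpret prob_space M by fact
  note rf = \<open>reverse_filtration M E\<close>
  have sub: "subalgebra M (E t)" if "1 \<le> t" for t
    using rf that by (auto simp: reverse_filtration_def)
  have int: "integrable M (X t)" "X t \<in> borel_measurable (E t)" if "1 \<le> t" for t
    using assms(3) that by (auto simp: reverse_submartingale_def)
  define A where "A t = {\<omega> \<in> space M. \<tau> \<omega> = t}" for t
  have A: "A t \<in> sets (E t)" if "1 \<le> t" for t
    using assms(5) that by (auto simp: reverse_stopping_time_def A_def)
  have A_M: "A t \<in> sets M" if "1 \<le> t" for t
    using A[OF that] sub[OF that] by (auto simp: subalgebra_def)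
  \<comment> \<open>With \<open>a * X 1\<close> as a density, the sum over \<open>t\<close> of its
    integrals over \<open>A t\<close> is handled by countable additivity of \<open>\<nu>\<close>,
    whose total mass is the desired bound.\<close>
  define \<nu> where "\<nu> = density M (\<lambda>\<omega>. ennreal (a * X 1 \<omega>))"
  \<comment> \<open>Up to the null set where \<open>U \<le> 0\<close>, \<open>S t\<close> is the event \<open>\<tau> = t \<and> U \<le> a X\<^sub>t\<close>; unlike the latter
    it compares \<open>U\<close> with a single \<open>E t\<close>-measurable variable.\<close>
  define S where "S t = {\<omega> \<in> space M. U \<omega> \<le> a * (indicator (A t) \<omega> * X t \<omega>)}" for t
  have S_M: "S t \<in> sets M" if "1 \<le> t" for t
    unfolding S_def using A_M[OF that] borel_measurable_integrable[OF int(1)[OF that]]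
      \<open>U \<in> borel_measurable M\<close>
    by (intro borel_measurable_le borel_measurable_times borel_measurable_const
        borel_measurable_indicator)
  have piece: "emeasure M (S t) \<le> emeasure \<nu> (A t)" if t: "1 \<le> t" for t
  proof -
    define Y where "Y \<omega> = a * (indicator (A t) \<omega> * X t \<omega>)" for \<omega>
    have Y: "Y \<in> borel_measurable (E t)"
      using A[OF t] int(2)[OF t] unfolding Y_def by simp
    have nonneg: "0 \<le> Y \<omega>" if "\<omega> \<in> space M" for \<omega>
      using assms(4,9) t that by (auto simp: Y_def)
    have int_ind: "integrable M (\<lambda>\<omega>. indicator (A t) \<omega> * X s \<omega>)" if "1 \<le> s" for s
      using integrable_mult_indicator[OF A_M[OF t] int(1)[OF that]] by simp
    have "emeasure M (S t) \<le> (\<integral>\<^sup>+\<omega>. ennreal (Y \<omega>) \<partial>M)"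
      unfolding S_def Y_def[symmetric]
      using assms(6,7) measurable_from_subalg[OF sub[OF t] Y]
        indep_of_family_imp_indep_var[OF assms(1) rf assms(6,8) t Y] nonneg
      by (rule emeasure_indep_uniform_le)
    also have "\<dots> = ennreal (a * (\<integral>\<omega>. indicator (A t) \<omega> * X t \<omega> \<partial>M))"
      using int_ind[OF t] nonneg
      by (subst nn_integral_eq_integral) (auto simp: Y_def[abs_def])
    \<comment> \<open>Here \<open>X t\<close> is exchanged for \<open>X 1\<close>, so that the
      bounds for all \<open>t\<close> involve one common integrand.\<close>
    also have "\<dots> \<le> ennreal (a * (\<integral>\<omega>. indicator (A t) \<omega> * X 1 \<omega> \<partial>M))"
      using reverse_submartingale_set_integral_le[OF assms(1) rf assms(3) t A[OF t]] assms(9)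
      by (intro ennreal_leI mult_left_mono) (auto simp: set_lebesgue_integral_def)
    also have "\<dots> = (\<integral>\<^sup>+\<omega>. ennreal (a * (indicator (A t) \<omega> * X 1 \<omega>)) \<partial>M)"
      using int_ind[of 1] assms(4,9)
      by (subst nn_integral_eq_integral) auto
    also have "\<dots> = emeasure \<nu> (A t)"
      unfolding \<nu>_def using A_M[OF t] borel_measurable_integrable[OF int(1)[of 1]]
      by (subst emeasure_density) (auto intro!: nn_integral_cong simp: indicator_def)
    finally show ?thesis .
  qed
  \<comment> \<open>Each point of the event lies in \<open>S t\<close> for
    \<open>t = \<tau> \<omega>\<close>; the shift to \<open>Suc n\<close> matches time starting at
    1.\<close>
  have "{\<omega> \<in> space M. X (\<tau> \<omega>) \<omega> \<ge> U \<omega> / a} \<subseteq> (\<Union>n. S (Suc n))"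
  proof
    fix \<omega> assume *: "\<omega> \<in> {\<omega> \<in> space M. X (\<tau> \<omega>) \<omega> \<ge> U \<omega> / a}"
    then have "1 \<le> \<tau> \<omega>"
      using assms(5) by (auto simp: reverse_stopping_time_def)
    moreover have "\<omega> \<in> S (\<tau> \<omega>)"
      using * assms(9) by (auto simp: S_def A_def field_simps)
    ultimately show "\<omega> \<in> (\<Union>n. S (Suc n))"
      by (metis One_nat_def Suc_le_D UN_I UNIV_I)
  qed
  then have "emeasure M {\<omega> \<in> space M. X (\<tau> \<omega>) \<omega> \<ge> U \<omega> / a} \<le> emeasure M (\<Union>n. S (Suc n))"
    using S_M by (intro emeasure_mono) auto
  \<comment> \<open>The sets \<open>S t\<close> can overlap where \<open>U \<le> 0\<close>, so
    subadditivity is used here, whereas the disjoint sets \<open>A t\<close> below give an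
    equality.\<close>
  also have "\<dots> \<le> (\<Sum>n. emeasure M (S (Suc n)))"
    using S_M by (intro emeasure_subadditive_countably) auto
  also have "\<dots> \<le> (\<Sum>n. emeasure \<nu> (A (Suc n)))"
    using piece by (intro suminf_le) auto
  also have "\<dots> = emeasure \<nu> (\<Union>n. A (Suc n))"
    using A_M by (intro suminf_emeasure) (auto simp: \<nu>_def A_def disjoint_family_on_def)
  also have "\<dots> \<le> emeasure \<nu> (space \<nu>)"
    by (rule emeasure_space)
  also have "\<dots> = (\<integral>\<^sup>+\<omega>. ennreal (a * X 1 \<omega>) \<partial>M)"
    using borel_measurable_integrable[OF int(1)[of 1]]
    by (simp add: \<nu>_def emeasure_density cong: nn_integral_cong)
  also have "\<dots> = ennreal (a * integral\<^sup>L M (X 1))"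
    using int(1)[of 1] assms(4,9) by (subst nn_integral_eq_integral) auto
  finally show ?thesis
    using assms(4,9)
    by (auto simp: measure_def intro!: enn2real_leI integral_nonneg_AE mult_nonneg_nonneg)
qed

end
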